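(* Let $d>2$ be a prime number, let $\mathcal{H}_d=\mathbb{C}^d$ with orthonormal computational basis $\{|0\rangle,\dots,|d-1\rangle\}$, let $X\in M(d,\mathbb{C})$ be a unitary matrix with $X^d=\mathbb{I}_d$ and $\operatorname{Tr}(X^iX^{j\dagger})=0$ for all $i\neq j$ in $\{0,\dots,d-1\}$, let $M_s=\operatorname{span}_{\mathbb{C}}\{X^0,X^1,\dots,X^{d-1}\}$, and let $G:\mathcal{H}_d\to M_s$ be the map $G(\sum_i a_i|i\rangle)=\sum_i a_iX^i$. Then for any $|\phi\rangle,|\varphi\rangle\in\mathcal{H}_d$, $$|\langle\phi|\varphi\rangle|=\frac1d\,\bigl|\operatorname{Tr}[G(|\phi\rangle)^\dagger G(|\varphi\rangle)]\bigr|.$$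
   Context: $M(d,\mathbb{C})$ is the space of $d\times d$ complex matrices, $\dagger$ denotes the conjugate transpose of a matrix, $\mathbb{I}_d$ is the identity matrix, and $\langle\cdot|\cdot\rangle$ is the standard inner product on $\mathbb{C}^d$. *)

theory Defs
  imports
    "HOL-Computational_Algebra.Primes"
    "Jordan_Normal_Form.Schur_Decomposition"
begin

definition mat_trace :: "complex mat \<Rightarrow> complex" where
  "mat_trace A = (\<Sum>i<dim_row A. A $$ (i, i))"

definition unitary_mat :: "nat \<Rightarrow> complex mat \<Rightarrow> bool" where
  "unitary_mat d U \<longleftrightarrow> U \<in> carrier_mat d d
     \<and> mat_adjoint U * U = 1\<^sub>m d \<and> U * mat_adjoint U = 1\<^sub>m d"

(* Conjugate-linear in the first argument; the library's product conjugates the second one. *)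
definition braket :: "complex vec \<Rightarrow> complex vec \<Rightarrow> complex" where
  "braket \<phi> \<psi> = \<psi> \<bullet>c \<phi>"

abbreviation mat_sum :: "nat \<Rightarrow> (nat \<Rightarrow> complex mat) \<Rightarrow> nat set \<Rightarrow> complex mat" where
  "mat_sum d \<equiv> finsum (module_mat TYPE(complex) d d)"

definition power_span :: "nat \<Rightarrow> complex mat \<Rightarrow> complex mat set" where
  "power_span d X = LinearCombinations.module.span class_ring (module_mat TYPE(complex) d d)
     ((\<lambda>i. X ^\<^sub>m i) ` {..<d})"

lemma mat_adjoint_dim [simp]:
  "A \<in> carrier_mat n m \<Longrightarrow> mat_adjoint A \<in> carrier_mat m n"
  unfolding mat_adjoint_def by (metis carrier_matD cols_length length_map mat_of_rows_carrier(1))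

lemma mat_adjoint_index:
  assumes "i < dim_col A" "j < dim_row A"
  shows "mat_adjoint A $$ (i, j) = cnj (A $$ (j, i))"
  using assms by (simp add: mat_adjoint_def mat_of_rows_index)

lemma braket_eq_sum:
  assumes "\<phi> \<in> carrier_vec d" "\<psi> \<in> carrier_vec d"
  shows "braket \<phi> \<psi> = (\<Sum>i<d. cnj (\<phi> $ i) * \<psi> $ i)"
  using assms by (simp add: braket_def scalar_prod_def atLeast0LessThan mult.commute)

lemma basis_expansion_index:
  assumes "j < d"
  shows "finsum_vec TYPE(complex) d (\<lambda>i. a i \<cdot>\<^sub>v unit_vec d i) {..<d} $ j = a j"
proof -
  have "finsum_vec TYPE(complex) d (\<lambda>i. a i \<cdot>\<^sub>v unit_vec d i) {..<d} $ j
      = (\<Sum>i<d. (a i \<cdot>\<^sub>v unit_vec d i) $ j)"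
    by (rule index_finsum_vec) (use assms in auto)
  also have "\<dots> = (\<Sum>i<d. if i = j then a j else 0)"
    by (rule sum.cong) (use assms in \<open>auto simp: unit_vec_def\<close>)
  finally show ?thesis using assms by simp
qed

lemma mat_sum_in_power_span:
  assumes X: "X \<in> carrier_mat d d"
  shows "mat_sum d (\<lambda>i. c i \<cdot>\<^sub>m X ^\<^sub>m i) {..<d} \<in> power_span d X"
proof -
  interpret W: matrix_vs d d "TYPE(complex)" .
  let ?P = "(\<lambda>i. X ^\<^sub>m i) ` {..<d}"
  have P: "?P \<subseteq> carrier_mat d d" using X by auto
  have sub: "submodule class_ring (W.span ?P) W.V" by (rule W.span_is_submodule[OF P])
  have gen: "X ^\<^sub>m i \<in> W.span ?P" if "i < d" for i
    using W.in_own_span[OF P] that by auto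
  have cl: "c i \<cdot>\<^sub>m X ^\<^sub>m i \<in> W.span ?P" if "i < d" for i
    using submodule.smult_closed[OF sub] gen[OF that] by (simp add: module_mat_simps)
  have "mat_sum d (\<lambda>i. c i \<cdot>\<^sub>m X ^\<^sub>m i) A \<in> W.span ?P" if "A \<subseteq> {..<d}" for A
    using finite_subset[OF that finite_lessThan] that
  proof (induction A rule: finite_induct)
    case empty
    show ?case using submodule.zero_closed[OF sub] by (simp add: module_mat_simps)
  next
    case (insert x F)
    have "mat_sum d (\<lambda>i. c i \<cdot>\<^sub>m X ^\<^sub>m i) (insert x F)
        = c x \<cdot>\<^sub>m X ^\<^sub>m x + mat_sum d (\<lambda>i. c i \<cdot>\<^sub>m X ^\<^sub>m i) F"
      using insert X by (subst W.finsum_insert) auto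
    moreover have "mat_sum d (\<lambda>i. c i \<cdot>\<^sub>m X ^\<^sub>m i) F \<in> W.span ?P" using insert by simp
    ultimately show ?case
      using submodule.m_closed[OF sub] cl insert.prems by (simp add: module_mat_simps)
  qed
  then show ?thesis by (simp add: power_span_def)
qed

(* The map fixed in the statement exists. *)
lemma power_map_exists:
  assumes "X \<in> carrier_mat d d"
  shows "\<exists>G. G \<in> carrier_vec d \<rightarrow> power_span d X \<and>
    (\<forall>a. G (finsum_vec TYPE(complex) d (\<lambda>i. a i \<cdot>\<^sub>v unit_vec d i) {..<d})
       = mat_sum d (\<lambda>i. a i \<cdot>\<^sub>m X ^\<^sub>m i) {..<d})"
proof (rule exI[of _ "\<lambda>v. mat_sum d (\<lambda>i. v $ i \<cdot>\<^sub>m X ^\<^sub>m i) {..<d}"], intro conjI allI)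
  show "(\<lambda>v. mat_sum d (\<lambda>i. v $ i \<cdot>\<^sub>m X ^\<^sub>m i) {..<d}) \<in> carrier_vec d \<rightarrow> power_span d X"
    using mat_sum_in_power_span[OF assms] by auto
  interpret W: matrix_vs d d "TYPE(complex)" .
  show "mat_sum d (\<lambda>i. finsum_vec TYPE(complex) d (\<lambda>i. a i \<cdot>\<^sub>v unit_vec d i) {..<d} $ i
      \<cdot>\<^sub>m X ^\<^sub>m i) {..<d} = mat_sum d (\<lambda>i. a i \<cdot>\<^sub>m X ^\<^sub>m i) {..<d}" for a
    by (rule W.finsum_cong') (use assms in \<open>auto simp: basis_expansion_index\<close>)
qed

end

theory Submission
  imports Defs
begin

text \<open>\<open>mat_trace (mat_adjoint A * B)\<close> is the Hilbert-Schmidt inner product. For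
  it the powers of \<open>X\<close> are orthogonal, and each has squared norm \<open>d\<close>
  because a power of a unitary matrix is unitary (\<open>unitary_mat_pow\<close>). So
  \<open>G\<close> sends the computational basis to an orthogonal family of vectors of squared norm
  \<open>d\<close>, and sesquilinearity gives Tr[G(\<phi>)^* G(\<psi>)] = d
  \<langle>\<phi>|\<psi>\<rangle>, even before moduli are taken. The calculation is done with
  entries: \<open>trace_adjoint_mult\<close> and \<open>mat_sum_index\<close> turn the trace into a
  fourfold sum of complex numbers, to be reordered.\<close>

lemma dim_mat_adjoint [simp]:
  "dim_row (mat_adjoint A) = dim_col A" "dim_col (mat_adjoint A) = dim_row A"
  using carrier_matD[OF mat_adjoint_dim[OF carrier_matI[OF refl refl]]] by auto

lemma mat_adjoint_mult:
  fixes A B :: "complex mat"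
  assumes "A \<in> carrier_mat n m" "B \<in> carrier_mat m k"
  shows "mat_adjoint (A * B) = mat_adjoint B * mat_adjoint A"
  by (rule eq_matI) (use assms[THEN carrier_matD(1)] assms[THEN carrier_matD(2)] in
    \<open>auto simp: mat_adjoint_index scalar_prod_def mult.commute\<close>)

lemma unitary_mat_mult:
  assumes "unitary_mat d U" "unitary_mat d V"
  shows "unitary_mat d (U * V)"
proof -
  have U: "U \<in> carrier_mat d d" and V: "V \<in> carrier_mat d d"
    using assms by (auto simp: unitary_mat_def)
  note U' = mat_adjoint_dim[OF U] and V' = mat_adjoint_dim[OF V]
  \<comment> \<open>Regrouping brings \<open>mat_adjoint U * U\<close> to the middle, where it
    cancels and leaves \<open>mat_adjoint V * V\<close>.\<close>
  have "mat_adjoint V * mat_adjoint U * (U * V) = mat_adjoint V * (mat_adjoint U * U * V)"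
    by (simp only: assoc_mult_mat[OF V' U' mult_carrier_mat[OF U V]] assoc_mult_mat[OF U' U V])
  then have "mat_adjoint (U * V) * (U * V) = 1\<^sub>m d"
    using assms left_mult_one_mat[OF V] by (simp add: unitary_mat_def mat_adjoint_mult[OF U V])
  moreover have "U * V * (mat_adjoint V * mat_adjoint U) = U * (V * mat_adjoint V * mat_adjoint U)"
    by (simp only: assoc_mult_mat[OF U V mult_carrier_mat[OF V' U']] assoc_mult_mat[OF V V' U'])
  then have "U * V * mat_adjoint (U * V) = 1\<^sub>m d"
    using assms left_mult_one_mat[OF U'] by (simp add: unitary_mat_def mat_adjoint_mult[OF U V])
  ultimately show ?thesis
    using U V by (simp add: unitary_mat_def)
qed

lemma unitary_mat_pow:
  assumes "unitary_mat d U"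
  shows "unitary_mat d (U ^\<^sub>m i)"
proof (induction i)
  case 0
  have "mat_adjoint (1\<^sub>m d) = (1\<^sub>m d :: complex mat)"
    by (intro eq_matI) (auto simp: mat_adjoint_index)
  then show ?case using assms by (auto simp: unitary_mat_def)
qed (simp add: unitary_mat_mult assms)

text \<open>The adjoint stands on the left in the conclusion of the theorem but on the right in its
  orthogonality hypothesis. This lemma and the next reduce both traces to the same entrywise sum,
  which does the work of cyclicity of the trace. The diagonal here runs over columns, hence the
  swap.\<close>

lemma trace_adjoint_mult:
  assumes "A \<in> carrier_mat d d" "B \<in> carrier_mat d d"
  shows "mat_trace (mat_adjoint A * B) = (\<Sum>r<d. \<Sum>c<d. cnj (A $$ (r, c)) * B $$ (r, c))"
proof -
  have "mat_trace (mat_adjoint A * B) = (\<Sum>c<d. \<Sum>r<d. cnj (A $$ (r, c)) * B $$ (r, c))"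
    using assms by (simp add: mat_trace_def scalar_prod_def mat_adjoint_index atLeast0LessThan)
  then show ?thesis by (subst sum.swap)
qed

lemma trace_mult_adjoint:
  assumes "A \<in> carrier_mat d d" "B \<in> carrier_mat d d"
  shows "mat_trace (B * mat_adjoint A) = (\<Sum>r<d. \<Sum>c<d. cnj (A $$ (r, c)) * B $$ (r, c))"
  using assms by (simp add: mat_trace_def scalar_prod_def mat_adjoint_index atLeast0LessThan mult.commute)

lemma mat_sum_carrier:
  assumes "\<And>i. i \<in> A \<Longrightarrow> f i \<in> carrier_mat d d"
  shows "mat_sum d f A \<in> carrier_mat d d"
proof -
  interpret W: matrix_vs d d "TYPE(complex)" .
  show ?thesis using W.finsum_closed[of f A] assms by (auto simp: module_mat_simps)
qed

lemma mat_sum_index: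
  assumes "finite A" "\<And>i. i \<in> A \<Longrightarrow> f i \<in> carrier_mat d d" "r < d" "c < d"
  shows "mat_sum d f A $$ (r, c) = (\<Sum>i\<in>A. f i $$ (r, c))"
  using assms(1,2)
proof (induction A rule: finite_induct)
  interpret W: matrix_vs d d "TYPE(complex)" .
  case empty
  show ?case using assms(3,4) by (simp add: module_mat_simps)
next
  interpret W: matrix_vs d d "TYPE(complex)" .
  case (insert x F)
  have "mat_sum d f (insert x F) = f x + mat_sum d f F"
    using insert by (subst W.finsum_insert) (auto simp: module_mat_simps)
  moreover have F: "mat_sum d f F \<in> carrier_mat d d"
    using insert.prems by (intro mat_sum_carrier) auto
  ultimately show ?case
    using insert assms(3,4) carrier_matD[OF F] by simp
qed

theorem lemma3:
  fixes d :: nat and X :: "complex mat" and G :: "complex vec \<Rightarrow> complex mat"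
    and \<phi> \<psi> :: "complex vec"
  assumes "prime d" and "d > 2"
    and "unitary_mat d X"
    and "X ^\<^sub>m d = 1\<^sub>m d"
    and "\<And>i j. i < d \<Longrightarrow> j < d \<Longrightarrow> i \<noteq> j \<Longrightarrow>
           mat_trace (X ^\<^sub>m i * mat_adjoint (X ^\<^sub>m j)) = 0"
    and "G \<in> carrier_vec d \<rightarrow> power_span d X"
    and "\<And>a. G (finsum_vec TYPE(complex) d (\<lambda>i. a i \<cdot>\<^sub>v unit_vec d i) {..<d})
           = mat_sum d (\<lambda>i. a i \<cdot>\<^sub>m X ^\<^sub>m i) {..<d}"
    and "\<phi> \<in> carrier_vec d" and "\<psi> \<in> carrier_vec d"
  shows "cmod (braket \<phi> \<psi>) = 1 / real d * cmod (mat_trace (mat_adjoint (G \<phi>) * G \<psi>))"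
proof -
  have X: "X ^\<^sub>m i \<in> carrier_mat d d" for i
    using assms(3) by (auto simp: unitary_mat_def)
  \<comment> \<open>\<open>G\<close> is prescribed only on expansions in the computational basis;
    every \<open>v\<close> is such an expansion, with its own entries as coefficients.\<close>
  have G: "G v = mat_sum d (\<lambda>i. v $ i \<cdot>\<^sub>m X ^\<^sub>m i) {..<d}" if v: "v \<in> carrier_vec d" for v
  proof -
    have "finsum_vec TYPE(complex) d (\<lambda>i. v $ i \<cdot>\<^sub>v unit_vec d i) {..<d} \<in> carrier_vec d"
      by (rule finsum_vec_closed) auto
    then have "finsum_vec TYPE(complex) d (\<lambda>i. v $ i \<cdot>\<^sub>v unit_vec d i) {..<d} = v"
      using v by (intro eq_vecI) (auto simp: basis_expansion_index)
    then show ?thesis using assms(7)[of "\<lambda>i. v $ i"] by simp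
  qed
  have Gc: "G v \<in> carrier_mat d d" if "v \<in> carrier_vec d" for v
    unfolding G[OF that] by (rule mat_sum_carrier) (simp add: X)
  have Gi: "G v $$ (r, c) = (\<Sum>i<d. v $ i * (X ^\<^sub>m i) $$ (r, c))"
    if "v \<in> carrier_vec d" "r < d" "c < d" for v r c
    unfolding G[OF that(1)] using that carrier_matD[OF X] by (subst mat_sum_index) (auto simp: X)
  \<comment> \<open>The Gram matrix of the powers of \<open>X\<close>: on the diagonal unitarity
    gives the trace of the identity, and off it the hypothesis applies with \<open>i\<close> and
    \<open>j\<close> exchanged, since the conjugated factor is the power \<open>i\<close>.\<close>
  have orth: "(\<Sum>r<d. \<Sum>c<d. cnj ((X ^\<^sub>m i) $$ (r, c)) * (X ^\<^sub>m j) $$ (r, c))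
      = (if i = j then of_nat d else 0)" if "i < d" "j < d" for i j
  proof (cases "i = j")
    case True
    then have "X ^\<^sub>m j * mat_adjoint (X ^\<^sub>m i) = 1\<^sub>m d"
      using unitary_mat_pow[OF assms(3)] by (simp add: unitary_mat_def)
    then show ?thesis
      using True by (simp add: trace_mult_adjoint[OF X X, symmetric] mat_trace_def)
  next
    case False
    then show ?thesis using assms(5)[of j i] that by (simp add: trace_mult_adjoint[OF X X, symmetric])
  qed
  have "mat_trace (mat_adjoint (G \<phi>) * G \<psi>)
      = (\<Sum>r<d. \<Sum>c<d. (\<Sum>i<d. cnj (\<phi> $ i) * cnj ((X ^\<^sub>m i) $$ (r, c)))
          * (\<Sum>j<d. \<psi> $ j * (X ^\<^sub>m j) $$ (r, c)))"
    using assms(8,9) by (simp add: trace_adjoint_mult[OF Gc Gc] Gi)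
  also have "\<dots> = (\<Sum>r<d. \<Sum>c<d. \<Sum>i<d. \<Sum>j<d. cnj (\<phi> $ i) * \<psi> $ j
          * (cnj ((X ^\<^sub>m i) $$ (r, c)) * (X ^\<^sub>m j) $$ (r, c)))"
    unfolding sum_product by (simp only: mult_ac)
  \<comment> \<open>The index \<open>i\<close> moves out past \<open>c\<close> and then past
    \<open>r\<close>. The next step does the same with \<open>j\<close> for fixed \<open>i\<close>,
    so that the coefficients factor out of the inner products in \<open>orth\<close>.\<close>
  also have "\<dots> = (\<Sum>i<d. \<Sum>r<d. \<Sum>c<d. \<Sum>j<d. cnj (\<phi> $ i) * \<psi> $ j
      * (cnj ((X ^\<^sub>m i) $$ (r, c)) * (X ^\<^sub>m j) $$ (r, c)))"
    by (subst (2) sum.swap, rule sum.swap)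
  also have "\<dots> = (\<Sum>i<d. \<Sum>j<d. cnj (\<phi> $ i) * \<psi> $ j
      * (\<Sum>r<d. \<Sum>c<d. cnj ((X ^\<^sub>m i) $$ (r, c)) * (X ^\<^sub>m j) $$ (r, c)))"
    unfolding sum_distrib_left
    by (intro sum.cong[OF refl] trans[OF sum.cong[OF refl sum.swap] sum.swap])
  also have "\<dots> = (\<Sum>i<d. \<Sum>j<d. if i = j then cnj (\<phi> $ i) * \<psi> $ i * of_nat d else 0)"
    by (intro sum.cong refl) (simp add: orth)
  also have "\<dots> = of_nat d * braket \<phi> \<psi>"
    using assms(8,9) by (simp add: braket_eq_sum sum_distrib_left mult_ac)
  \<comment> \<open>Moduli are taken, and the factor \<open>d\<close>, nonzero by
    \<open>d > 2\<close>, cancels.\<close>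
  finally show ?thesis using assms(2) by (simp add: norm_mult)
qed

end
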